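(* Let $M \subseteq [\omega]^\omega$ be a large $EL$-open set. Then there is no partition $\mathcal{F}$ of $M$ such that $\mathcal{F}$ is a large partition of $M$ into $NR$-sets, $M$ is $EL$-dense with respect to $\mathcal{F}$, and $\mathcal{F}$ is a Kuratowski partition (i.e. no large $EL$-dense $EL$-open set admits a Kuratowski partition).
   Context: For $a \in [\omega]^{<\omega}$ and $A \in [\omega]^\omega$ let $[a, A] = \{B \in [A]^\omega \colon a \subset B \subseteq a \cup A\}$. The Ellentuck topology on $[\omega]^\omega$ is the topology generated by the sets $[a,A]$; $EL$-open means open in this topology. A set $M \subseteq [\omega]^\omega$ is completely Ramsey ($CR$) if for every $[a, A]$ there is $B \in [A]^\omega$ with $[a, B] \subseteq M$ or $[a, B] \cap M = \emptyset$; it is nowhere Ramsey ($NR$) if for every $[a, A]$ there is $B \in [A]^\omega$ with $[a, B] \cap M = \emptyset$. A set is large if it is not $NR$; a family of sets is large if its union is large. Given a large $EL$-open $M$ and a large partition $\mathcal{F}$ of $M$ into $NR$-sets, $M$ is $EL$-dense (with respect to $\mathcal{F}$) if for every $[a, A]$ such that $M \cap [a, A]$ is large, the family $\{F \in \mathcal{F} \colon F \cap [a, A] \neq \emptyset\}$ is large. A partition $\mathcal{F}$ of $M$ is a Kuratowski partition (in the Ellentuck setting) if for every subfamily $\mathcal{F}' \subseteq \mathcal{F}$ the set $\bigcup \mathcal{F}'$ is a $CR$-set (the $CR$-sets playing the role of sets with the Baire property).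
   Formalization: The basic set [a,A] is taken as all infinite B ⊆ ω with a ⊆ B ⊆ a ∪ A (the standard Ellentuck set) rather than B ∈ [A]^ω; read literally, partitioning [ω]^ω by minimum would refute the claim. *)

theory Defs
  imports "HOL-Analysis.Analysis" "HOL-Library.Disjoint_Sets"
begin

definition inf_subsets :: "nat set \<Rightarrow> nat set set" where
  "inf_subsets A = {B. B \<subseteq> A \<and> infinite B}"

text \<open>The basic sets \<open>[a, A]\<close>, meant for finite \<open>a\<close> and infinite \<open>A\<close>. The members range over
  all infinite sets of naturals: requiring them to be subsets of \<open>A\<close> would make \<open>[a, A]\<close> empty
  unless \<open>a \<subseteq> A\<close>, so that the conditions below would be vacuous for nonempty \<open>a\<close>
  (choose \<open>B\<close> disjoint from \<open>a\<close>). No condition \<open>max a < min A\<close> is imposed.\<close>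

definition ellentuck_basic :: "nat set \<Rightarrow> nat set \<Rightarrow> nat set set" where
  "ellentuck_basic a A = {B \<in> inf_subsets UNIV. a \<subseteq> B \<and> B \<subseteq> a \<union> A}"

definition ellentuck_topology :: "nat set topology" where
  "ellentuck_topology =
     topology_generated_by {ellentuck_basic a A |a A. finite a \<and> infinite A}"

abbreviation EL_open :: "nat set set \<Rightarrow> bool" where
  "EL_open M \<equiv> openin ellentuck_topology M"

definition completely_Ramsey :: "nat set set \<Rightarrow> bool" where
  "completely_Ramsey M \<longleftrightarrow>
     (\<forall>a A. finite a \<and> infinite A \<longrightarrow>
        (\<exists>B \<in> inf_subsets A. ellentuck_basic a B \<subseteq> M \<or> ellentuck_basic a B \<inter> M = {}))"

definition nowhere_Ramsey :: "nat set set \<Rightarrow> bool" where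
  "nowhere_Ramsey M \<longleftrightarrow>
     (\<forall>a A. finite a \<and> infinite A \<longrightarrow>
        (\<exists>B \<in> inf_subsets A. ellentuck_basic a B \<inter> M = {}))"

definition large :: "nat set set \<Rightarrow> bool" where
  "large M \<longleftrightarrow> \<not> nowhere_Ramsey M"

definition large_family :: "nat set set set \<Rightarrow> bool" where
  "large_family \<F> \<longleftrightarrow> large (\<Union>\<F>)"

definition large_NR_partition :: "nat set set \<Rightarrow> nat set set set \<Rightarrow> bool" where
  "large_NR_partition M \<F> \<longleftrightarrow>
     partition_on M \<F> \<and> large_family \<F> \<and> (\<forall>F \<in> \<F>. nowhere_Ramsey F)"

definition EL_dense :: "nat set set \<Rightarrow> nat set set set \<Rightarrow> bool" where
  "EL_dense M \<F> \<longleftrightarrow>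
     (\<forall>a A. finite a \<and> infinite A \<and> large (M \<inter> ellentuck_basic a A) \<longrightarrow>
        large_family {F \<in> \<F>. F \<inter> ellentuck_basic a A \<noteq> {}})"

definition Kuratowski_partition :: "nat set set \<Rightarrow> nat set set set \<Rightarrow> bool" where
  "Kuratowski_partition M \<F> \<longleftrightarrow>
     partition_on M \<F> \<and> (\<forall>\<F>' \<subseteq> \<F>. completely_Ramsey (\<Union>\<F>'))"

end

theory Submission
  imports Defs
begin

text \<open>
  By a fusion argument the \<open>NR\<close>-sets form a \<open>\<sigma>\<close>-ideal. Hence, if \<open>\<F>\<close> is a Kuratowski
  partition of \<open>M\<close> into \<open>NR\<close>-sets and \<open>[a, A] \<subseteq> M\<close>, some subfamily of \<open>\<F>\<close> and its complement
  both have a large union inside \<open>[a, A]\<close>: otherwise the subfamilies with large union would form a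
  \<open>\<sigma>\<close>-complete nonprincipal ultrafilter on \<open>\<F>\<close>, which is impossible since \<open>\<F>\<close> has at most
  continuum many members. As these unions are \<open>CR\<close>, each of them contains a basic subset of
  \<open>[a, A]\<close>. Iterating this along the binary tree shows that every \<open>[a, B]\<close> with \<open>B \<subseteq> A\<close> meets
  continuum many members of \<open>\<F>\<close>. There are only continuum many \<open>B\<close>, so a Bernstein construction
  yields a subfamily whose union and its complement meet all these \<open>[a, B]\<close>, i.e. a union that is
  not \<open>CR\<close>.
\<close>

section \<open>Distinct representatives by transfinite recursion\<close>

text \<open>Along a well-order of \<open>'i\<close> of minimal type, every proper initial segment is
  smaller than \<open>'i\<close>. The values taken earlier therefore cannot exhaust
  \<open>S i\<close>, which contains a copy of \<open>'i\<close>.\<close>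

lemma injective_choice_function:
  fixes S :: "'i \<Rightarrow> 'b set"
  assumes "\<And>i. \<exists>g::'i \<Rightarrow> 'b. inj g \<and> range g \<subseteq> S i"
  shows "\<exists>p. inj p \<and> (\<forall>i. p i \<in> S i)"
proof -
  include cardinal_syntax
  define r where "r = |UNIV :: 'i set|"
  have co: "Card_order r" and fld: "Field r = UNIV" and wo: "Well_order r"
    unfolding r_def by (rule card_of_Card_order, rule Field_card_of, rule card_of_Well_order)
  have wf: "wf (r - Id)"
    using wo by (simp add: well_order_on_def)
  have tot: "total r"
    using wo fld by (simp add: well_order_on_def linear_order_on_def)
  have "\<exists>p. \<forall>i. p i \<in> S i \<and> (\<forall>j. (j, i) \<in> r - Id \<longrightarrow> p j \<noteq> p i)"
  proof (rule dependent_wf_choice[OF wf])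
    fix i :: 'i and p :: "'i \<Rightarrow> 'b"
    obtain g :: "'i \<Rightarrow> 'b" where g: "inj g" "range g \<subseteq> S i"
      using assms by blast
    have "\<not> range g \<subseteq> p ` underS r i"
    proof
      assume "range g \<subseteq> p ` underS r i"
      then have "|UNIV :: 'i set| \<le>o |p ` underS r i|"
        using g(1) card_of_ordLeq by blast
      also have "|p ` underS r i| \<le>o |underS r i|"
        by (rule card_of_image)
      also (ordLeq_transitive) have "|underS r i| <o r"
        using card_of_underS[OF co] fld by simp
      finally (ordLeq_ordLess_trans) show False
        using r_def ordLess_irreflexive by blast
    qed
    then obtain y where "y \<in> S i" "y \<notin> p ` underS r i"
      using g(2) by blast
    then show "\<exists>y. y \<in> S i \<and> (\<forall>j. (j, i) \<in> r - Id \<longrightarrow> p j \<noteq> y)"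
      by (auto simp: underS_def)
  qed auto
  then obtain p where p: "\<And>i. p i \<in> S i" "\<And>i j. (j, i) \<in> r - Id \<Longrightarrow> p j \<noteq> p i"
    by blast
  have "inj p"
  proof (rule injI, rule ccontr)
    fix i j assume "p i = p j" "i \<noteq> j"
    then show False
      using p(2)[of i j] p(2)[of j i] tot by (auto simp: total_on_def)
  qed
  then show ?thesis using p(1) by blast
qed

section \<open>Basic sets and NR-sets\<close>

lemma basic_mono:
  "a \<subseteq> a' \<Longrightarrow> a' \<union> A' \<subseteq> a \<union> A \<Longrightarrow> ellentuck_basic a' A' \<subseteq> ellentuck_basic a A"
  unfolding ellentuck_basic_def by auto

lemma basic_self: "infinite A \<Longrightarrow> a \<union> A \<in> ellentuck_basic a A"
  unfolding ellentuck_basic_def inf_subsets_def by auto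

lemma NR_subset: "nowhere_Ramsey N \<Longrightarrow> N' \<subseteq> N \<Longrightarrow> nowhere_Ramsey N'"
  unfolding nowhere_Ramsey_def by (meson disjoint_iff subsetD)

lemma basic_not_NR:
  assumes "finite a" "infinite A"
  shows "\<not> nowhere_Ramsey (ellentuck_basic a A)"
proof
  assume "nowhere_Ramsey (ellentuck_basic a A)"
  then obtain B where B: "B \<subseteq> A" "infinite B"
    and "ellentuck_basic a B \<inter> ellentuck_basic a A = {}"
    using assms unfolding nowhere_Ramsey_def inf_subsets_def by blast
  moreover have "ellentuck_basic a B \<subseteq> ellentuck_basic a A"
    using B by (intro basic_mono) auto
  ultimately show False
    using basic_self[OF B(2), of a] by blast
qed

text \<open>Shrinking the reservoir keeps the disjointness already reached, so the pairs can be
  treated one at a time. This performs a single step of the fusion below.\<close>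

lemma NR_avoid_finitely_many:
  assumes "finite P" "\<And>a N. (a, N) \<in> P \<Longrightarrow> finite a \<and> nowhere_Ramsey N" "infinite A"
  shows "\<exists>B \<subseteq> A. infinite B \<and> (\<forall>(a, N) \<in> P. ellentuck_basic a B \<inter> N = {})"
  using assms
proof (induction P rule: finite_induct)
  case empty
  then show ?case by auto
next
  case (insert q P)
  obtain a N where q: "q = (a, N)" by fastforce
  obtain B where B: "B \<subseteq> A" "infinite B" "\<forall>(a, N) \<in> P. ellentuck_basic a B \<inter> N = {}"
    using insert.IH[OF _ insert.prems(2)] insert.prems(1) by blast
  obtain C where C: "C \<subseteq> B" "infinite C" "ellentuck_basic a C \<inter> N = {}"
    using insert.prems(1)[of a N] q B(2) unfolding nowhere_Ramsey_def inf_subsets_def by blast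
  have "ellentuck_basic a' C \<subseteq> ellentuck_basic a' B" for a'
    using C(1) by (intro basic_mono) auto
  then have "\<forall>(a, N) \<in> insert q P. ellentuck_basic a C \<inter> N = {}"
    using B(3) C(3) q by fast
  then show ?case
    using C(2) order_trans[OF C(1) B(1)] by (intro exI[of _ C]) blast
qed

section \<open>Fusion and the \<sigma>-ideal of NR-sets\<close>

text \<open>The stems \<open>s n\<close> increase while the sets \<open>s n \<union> B n\<close>
  decrease, so whatever enters a stem after stage \<open>m\<close> already lies in
  \<open>s m \<union> B m\<close>.\<close>

lemma fusion_limit:
  fixes s B :: "nat \<Rightarrow> nat set"
  assumes fin: "\<And>n. finite (s n)" and strict: "\<And>n. s n \<subset> s (Suc n)"
    and dec: "\<And>n. s (Suc n) \<union> B (Suc n) \<subseteq> s n \<union> B n"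
  shows "infinite (\<Union>n. s n)" "(\<Union>n. s n) \<subseteq> s m \<union> B m"
proof -
  show "infinite (\<Union>n. s n)"
  proof
    assume bdd: "finite (\<Union>n. s n)"
    have "n \<le> card (s n)" for n
    proof (induction n)
      case (Suc n)
      have "card (s n) < card (s (Suc n))"
        using fin strict by (simp add: psubset_card_mono)
      then show ?case using Suc by simp
    qed simp
    moreover have "card (s n) \<le> card (\<Union>n. s n)" for n
      using bdd by (intro card_mono) auto
    ultimately have "Suc (card (\<Union>n. s n)) \<le> card (\<Union>n. s n)"
      using order_trans by fast
    then show False by simp
  qed
  have mono: "s n \<subseteq> s m" if "n \<le> m" for n
    using lift_Suc_mono_le[of s n m] strict that by blast
  have anti: "s n \<union> B n \<subseteq> s m \<union> B m" if "m \<le> n" for n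
    using lift_Suc_antimono_le[of "\<lambda>n. s n \<union> B n" m n] dec that by blast
  show "(\<Union>n. s n) \<subseteq> s m \<union> B m"
  proof
    fix k assume "k \<in> (\<Union>n. s n)"
    then obtain n where "k \<in> s n" by blast
    then show "k \<in> s m \<union> B m"
      using mono[of n] anti[of n] by (cases "n \<le> m") auto
  qed
qed

lemma NR_UN:
  fixes N :: "nat \<Rightarrow> nat set set"
  assumes NR: "\<And>n. nowhere_Ramsey (N n)"
  shows "nowhere_Ramsey (\<Union>n. N n)"
  unfolding nowhere_Ramsey_def
proof (intro allI impI, elim conjE)
  fix a A :: "nat set" assume a: "finite a" and A: "infinite A"
  \<comment> \<open>A state of the fusion is the finite set of elements chosen so far and the current reservoir.\<close>
  define P where "P = (\<lambda>(n::nat) (s::nat set, B::nat set). finite s \<and> infinite B \<and> s \<union> B \<subseteq> A \<and>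
    (\<forall>t \<subseteq> s. \<forall>i < n. ellentuck_basic (a \<union> t) B \<inter> N i = {}))"
  define Q where "Q = (\<lambda>(n::nat) (s::nat set, B::nat set) (s', B').
    s \<subset> s' \<and> s' \<union> B' \<subseteq> s \<union> B)"
  have "\<exists>f. \<forall>n. P n (f n) \<and> Q n (f n) (f (Suc n))"
  proof (rule dependent_nat_choice)
    show "\<exists>x. P 0 x"
      by (rule exI[of _ "({}, A)"]) (use A in \<open>auto simp: P_def\<close>)
  next
    fix x n assume "P n x"
    then obtain s B where x: "x = (s, B)" and s: "finite s" and B: "infinite B" and sub: "s \<union> B \<subseteq> A"
      unfolding P_def by auto
    obtain k where k: "k \<in> B" "k \<notin> s"
      using B s by (meson finite_subset subsetI)
    \<comment> \<open>A member of the final basic set may contain any part of the stem, so each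
      subset of the enlarged stem gives its own requirement. Only \<open>N 0\<close> to
      \<open>N n\<close> are treated now, which keeps \<open>R\<close> finite.\<close>
    define R where "R = (\<lambda>(t, i). (a \<union> t, N i)) ` (Pow (insert k s) \<times> {..<Suc n})"
    have "finite R" unfolding R_def using s by auto
    moreover have "finite b \<and> nowhere_Ramsey L" if "(b, L) \<in> R" for b L
      using that a s NR unfolding R_def by (auto intro: finite_subset)
    ultimately obtain C where C: "C \<subseteq> B" "infinite C"
        "\<forall>(b, L) \<in> R. ellentuck_basic b C \<inter> L = {}"
      using NR_avoid_finitely_many[of R B] B by blast
    have "ellentuck_basic (a \<union> t) C \<inter> N i = {}" if "t \<subseteq> insert k s" "i < Suc n" for t i
    proof -
      have "(a \<union> t, N i) \<in> R"
        unfolding R_def using that by (auto intro!: image_eqI[of _ _ "(t, i)"])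
      then show ?thesis using C(3) by fast
    qed
    then have "P (Suc n) (insert k s, C)" "Q n x (insert k s, C)"
      using s C sub k x by (auto simp: P_def Q_def)
    then show "\<exists>y. P (Suc n) y \<and> Q n x y" by blast
  qed
  then obtain f where f: "\<And>n. P n (f n)" "\<And>n. Q n (f n) (f (Suc n))" by blast
  define s where "s = fst \<circ> f"
  define B where "B = snd \<circ> f"
  have P: "finite (s n)" "s n \<union> B n \<subseteq> A"
      "\<And>t i. t \<subseteq> s n \<Longrightarrow> i < n \<Longrightarrow> ellentuck_basic (a \<union> t) (B n) \<inter> N i = {}"
    and Q: "s n \<subset> s (Suc n)" "s (Suc n) \<union> B (Suc n) \<subseteq> s n \<union> B n" for n
    using f(1)[of n] f(2)[of n] by (auto simp: P_def Q_def s_def B_def split_beta)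
  define D where "D = (\<Union>n. s n)"
  have "infinite D"
    using fusion_limit(1)[of s B] P(1) Q by (simp add: D_def)
  moreover have "D \<subseteq> A" using P(2) by (auto simp: D_def)
  moreover have "X \<notin> N i" if X: "X \<in> ellentuck_basic a D" for X i
  proof -
    have "D \<subseteq> s (Suc i) \<union> B (Suc i)"
      using fusion_limit(2)[of s B] P(1) Q by (simp add: D_def)
    \<comment> \<open>The trace of \<open>X\<close> on the stem serves as \<open>t\<close>. Stage
      \<open>Suc i\<close> is the first one that takes care of \<open>N i\<close>.\<close>
    then have "X \<in> ellentuck_basic (a \<union> (X \<inter> s (Suc i))) (B (Suc i))"
      using X unfolding ellentuck_basic_def by blast
    then show ?thesis
      using P(3)[of "X \<inter> s (Suc i)" "Suc i" i] by blast
  qed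
  ultimately show "\<exists>B\<in>inf_subsets A. ellentuck_basic a B \<inter> (\<Union>n. N n) = {}"
    unfolding inf_subsets_def by blast
qed

lemma NR_Un:
  assumes "nowhere_Ramsey N" "nowhere_Ramsey N'"
  shows "nowhere_Ramsey (N \<union> N')"
proof -
  have "nowhere_Ramsey (\<Union>n::nat. if n = 0 then N else N')"
    using assms by (intro NR_UN) auto
  then show ?thesis by (rule NR_subset) (auto split: if_splits)
qed

section \<open>Kuratowski partitions into NR-sets\<close>

locale NR_Kuratowski_partition =
  fixes M :: "nat set set" and \<F> :: "nat set set set"
  assumes partition: "partition_on M \<F>"
    and NR_class: "\<And>F. F \<in> \<F> \<Longrightarrow> nowhere_Ramsey F"
    and CR_Union: "\<And>\<G>. \<G> \<subseteq> \<F> \<Longrightarrow> completely_Ramsey (\<Union>\<G>)"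
begin

lemma class_unique: "F \<in> \<F> \<Longrightarrow> G \<in> \<F> \<Longrightarrow> X \<in> F \<Longrightarrow> X \<in> G \<Longrightarrow> F = G"
  using partition by (auto simp: partition_on_def disjoint_def)

lemma exists_subfamily_large_colarge:
  assumes a: "finite a" and A: "infinite A" and sub: "ellentuck_basic a A \<subseteq> M"
  shows "\<exists>\<G> \<subseteq> \<F>. \<not> nowhere_Ramsey (\<Union>\<G> \<inter> ellentuck_basic a A) \<and>
    \<not> nowhere_Ramsey (\<Union>(\<F> - \<G>) \<inter> ellentuck_basic a A)"
proof (rule ccontr)
  let ?E = "ellentuck_basic a A"
  assume neg: "\<not> ?thesis"
  define rep where "rep = (\<lambda>F::nat set set. SOME X. X \<in> F)"
  have rep: "rep F \<in> F" if "F \<in> \<F>" for F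
    using that partition unfolding rep_def partition_on_def by (metis some_in_eq)
  \<comment> \<open>Representatives are sets of naturals, so asking whether \<open>n\<close> belongs
    to them gives countably many splittings of \<open>\<F>\<close> that together separate its
    members.\<close>
  define S where "S = (\<lambda>n. {F \<in> \<F>. n \<in> rep F})"
  \<comment> \<open>By \<open>neg\<close> each splitting has a side that is NR inside
    \<open>?E\<close>; \<open>G n\<close> is such a side. At most one class survives the removal of
    all of them, so \<open>?E\<close> would be covered by countably many NR-sets.\<close>
  define G where "G = (\<lambda>n. if nowhere_Ramsey (\<Union>(S n) \<inter> ?E) then S n else \<F> - S n)"
  have S: "S n \<subseteq> \<F>" for n by (auto simp: S_def)
  have G: "nowhere_Ramsey (\<Union>(G n) \<inter> ?E)" for n
    using neg S[of n] by (auto simp: G_def)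
  define R where "R = \<F> - (\<Union>n. G n)"
  have one: "F = F'" if "F \<in> R" "F' \<in> R" for F F'
  proof -
    have "n \<in> rep F \<longleftrightarrow> n \<in> rep F'" for n
      using that by (auto simp: R_def G_def S_def split: if_splits)
    then have "rep F = rep F'" by blast
    then show ?thesis
      using rep[of F] rep[of F'] class_unique that by (auto simp: R_def)
  qed
  have "nowhere_Ramsey (\<Union>R)"
  proof (cases "R = {}")
    case True
    then show ?thesis
      by (auto simp: nowhere_Ramsey_def inf_subsets_def)
  next
    case False
    then obtain F where "F \<in> R" by blast
    then have "R = {F}" using one by blast
    then show ?thesis using NR_class[of F] by (auto simp: R_def)
  qed
  then have "nowhere_Ramsey ((\<Union>n. \<Union>(G n) \<inter> ?E) \<union> \<Union>R)"
    by (rule NR_Un[OF NR_UN[OF G]])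
  moreover have "?E \<subseteq> (\<Union>n. \<Union>(G n) \<inter> ?E) \<union> \<Union>R"
  proof
    fix X assume X: "X \<in> ?E"
    then obtain F where "F \<in> \<F>" "X \<in> F"
      using sub partition by (auto simp: partition_on_def)
    then show "X \<in> (\<Union>n. \<Union>(G n) \<inter> ?E) \<union> \<Union>R"
      using X by (auto simp: R_def)
  qed
  ultimately show False
    using NR_subset basic_not_NR[OF a A] by metis
qed

text \<open>Largeness gives a \<open>[c, C]\<close> that rules out the disjoint alternative of CR. A
  common member \<open>X\<close> of the resulting basic set and of \<open>[a, A]\<close> then serves
  as a reservoir compatible with both stems.\<close>

lemma large_union_contains_basic:
  assumes G: "\<G> \<subseteq> \<F>" and large: "\<not> nowhere_Ramsey (\<Union>\<G> \<inter> ellentuck_basic a A)"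
    and a: "finite a"
  shows "\<exists>b X. finite b \<and> infinite X \<and> a \<subset> b \<and> b \<union> X \<subseteq> a \<union> A \<and> ellentuck_basic b X \<subseteq> \<Union>\<G>"
proof -
  obtain c C where c: "finite c" "infinite C"
    and meets: "\<And>B. B \<in> inf_subsets C \<Longrightarrow> ellentuck_basic c B \<inter> (\<Union>\<G> \<inter> ellentuck_basic a A) \<noteq> {}"
    using large unfolding nowhere_Ramsey_def by blast
  obtain B where B: "B \<in> inf_subsets C"
    "ellentuck_basic c B \<subseteq> \<Union>\<G> \<or> ellentuck_basic c B \<inter> \<Union>\<G> = {}"
    using CR_Union[OF G] c unfolding completely_Ramsey_def by blast
  then have sub: "ellentuck_basic c B \<subseteq> \<Union>\<G>"
    using meets[OF B(1)] by blast
  obtain X where "X \<in> ellentuck_basic c B" "X \<in> ellentuck_basic a A"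
    using meets[OF B(1)] by blast
  then have X: "c \<subseteq> X" "X \<subseteq> c \<union> B" "a \<subseteq> X" "X \<subseteq> a \<union> A" "infinite X"
    unfolding ellentuck_basic_def inf_subsets_def by auto
  \<comment> \<open>The extra element makes the stem grow strictly, as \<open>fusion_limit\<close>
    demands.\<close>
  obtain k where k: "k \<in> X" "k \<notin> a"
    using X(5) a by (meson finite_subset subsetI)
  have "ellentuck_basic (insert k (a \<union> c)) X \<subseteq> ellentuck_basic c B"
    using X k by (intro basic_mono) auto
  then have "finite (insert k (a \<union> c)) \<and> infinite X \<and> a \<subset> insert k (a \<union> c) \<and>
      insert k (a \<union> c) \<union> X \<subseteq> a \<union> A \<and> ellentuck_basic (insert k (a \<union> c)) X \<subseteq> \<Union>\<G>"
    using X k a c sub by auto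
  then show ?thesis by blast
qed

text \<open>Every basic set inside \<open>M\<close> contains two smaller ones such that no class
  meets both. Along the binary tree of such splittings, fusion gives each branch a limit point, and
  different branches end in different classes.\<close>

lemma continuum_many_classes:
  assumes a: "finite a" and A: "infinite A" and sub: "ellentuck_basic a A \<subseteq> M"
  shows "\<exists>h :: nat set \<Rightarrow> nat set set. inj h \<and>
    range h \<subseteq> {F \<in> \<F>. F \<inter> ellentuck_basic a A \<noteq> {}}"
proof -
  define good where "good = (\<lambda>(b, B). finite b \<and> infinite B \<and> ellentuck_basic b B \<subseteq> M)"
  define below where "below = (\<lambda>(b', B') (b, B). b \<subset> b' \<and> b' \<union> B' \<subseteq> b \<union> (B::nat set))"
  define E where "E = (\<lambda>(b, B). ellentuck_basic b B)"
  have "\<exists>q0 q1. good q0 \<and> good q1 \<and> below q0 p \<and> below q1 p \<and>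
      (\<forall>F\<in>\<F>. F \<inter> E q0 = {} \<or> F \<inter> E q1 = {})" if "good p" for p
  proof -
    obtain b B where p: "p = (b, B)" by fastforce
    have b: "finite b" "infinite B" "ellentuck_basic b B \<subseteq> M"
      using that by (auto simp: good_def p)
    obtain \<G> where G: "\<G> \<subseteq> \<F>" "\<not> nowhere_Ramsey (\<Union>\<G> \<inter> ellentuck_basic b B)"
      "\<not> nowhere_Ramsey (\<Union>(\<F> - \<G>) \<inter> ellentuck_basic b B)"
      using exists_subfamily_large_colarge[OF b] by blast
    have M: "\<Union>\<F> = M" using partition by (simp add: partition_on_def)
    obtain b0 B0 where 0: "finite b0" "infinite B0" "b \<subset> b0" "b0 \<union> B0 \<subseteq> b \<union> B"
      "ellentuck_basic b0 B0 \<subseteq> \<Union>\<G>"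
      using large_union_contains_basic[OF G(1,2) b(1)] by blast
    obtain b1 B1 where 1: "finite b1" "infinite B1" "b \<subset> b1" "b1 \<union> B1 \<subseteq> b \<union> B"
      "ellentuck_basic b1 B1 \<subseteq> \<Union>(\<F> - \<G>)"
      using large_union_contains_basic[OF _ G(3) b(1)] by blast
    have disj: "F \<inter> E (b0, B0) = {} \<or> F \<inter> E (b1, B1) = {}" if F: "F \<in> \<F>" for F
    proof (cases "F \<in> \<G>")
      case True
      then have "F \<inter> \<Union>(\<F> - \<G>) = {}" using class_unique[OF F] by auto
      then show ?thesis using 1(5) by (auto simp: E_def)
    next
      case False
      then have "F \<inter> \<Union>\<G> = {}" using class_unique[OF F] G(1) by auto
      then show ?thesis using 0(5) by (auto simp: E_def)
    qed
    have "\<Union>\<G> \<subseteq> M" "\<Union>(\<F> - \<G>) \<subseteq> M"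
      using G(1) M by auto
    then have "good (b0, B0)" "good (b1, B1)" "below (b0, B0) p" "below (b1, B1) p"
      using 0 1 by (simp_all add: good_def below_def p subset_trans)
    then show ?thesis
      using disj by (intro exI[of _ "(b0, B0)"] exI[of _ "(b1, B1)"]) simp
  qed
  then obtain s0 s1 where s: "\<And>p. good p \<Longrightarrow> good (s0 p) \<and> good (s1 p) \<and> below (s0 p) p \<and>
      below (s1 p) p \<and> (\<forall>F\<in>\<F>. F \<inter> E (s0 p) = {} \<or> F \<inter> E (s1 p) = {})"
    by metis
  \<comment> \<open>\<open>T x n\<close> is the node at level \<open>n\<close> on the branch coded
    by \<open>x\<close>; membership of \<open>n\<close> in \<open>x\<close> decides the next
    turn.\<close>
  define T where "T = (\<lambda>x. rec_nat (a, A) (\<lambda>n p. if n \<in> (x::nat set) then s1 p else s0 p))"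
  have T0: "T x 0 = (a, A)" and
    TS: "T x (Suc n) = (if n \<in> x then s1 (T x n) else s0 (T x n))" for x n
    by (simp_all add: T_def)
  have good: "good (T x n)" for x n
  proof (induction n)
    case 0
    then show ?case using assms by (auto simp: T0 good_def)
  next
    case (Suc n)
    then show ?case using s by (auto simp: TS)
  qed
  have below: "below (T x (Suc n)) (T x n)" for x n
    using s[OF good] by (simp add: TS)
  define b where "b = (\<lambda>x n. fst (T x n))"
  define B where "B = (\<lambda>x n. snd (T x n))"
  have b: "finite (b x n)" "b x n \<subset> b x (Suc n)"
    "b x (Suc n) \<union> B x (Suc n) \<subseteq> b x n \<union> B x n" for x n
    using good[of x n] below[of x n] by (auto simp: good_def below_def b_def B_def split_beta)
  define L where "L = (\<lambda>x. \<Union>n. b x n)"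
  have L: "L x \<in> E (T x n)" for x n
  proof -
    have "infinite (L x)" "L x \<subseteq> b x n \<union> B x n"
      using fusion_limit[of "b x" "B x"] b by (simp_all add: L_def)
    then show ?thesis
      by (auto simp: E_def ellentuck_basic_def inf_subsets_def L_def b_def B_def split_beta)
  qed
  have LA: "L x \<in> ellentuck_basic a A" for x
    using L[of x 0] by (simp add: T0 E_def)
  then have "\<exists>F. F \<in> \<F> \<and> L x \<in> F" for x
    using sub partition by (auto simp: partition_on_def)
  then obtain h where h: "\<And>x. h x \<in> \<F>" "\<And>x. L x \<in> h x" by metis
  have "inj h"
  proof (rule injI, rule ccontr)
    fix x y assume eq: "h x = h y" and "x \<noteq> y"
    then have ex: "\<exists>n. (n \<in> x) \<noteq> (n \<in> y)" by blast
    \<comment> \<open>The two branches share their nodes up to level \<open>n\<close> and part at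
      level \<open>Suc n\<close>.\<close>
    define n where "n = (LEAST n. (n \<in> x) \<noteq> (n \<in> y))"
    have n: "(n \<in> x) \<noteq> (n \<in> y)" using LeastI_ex[OF ex] by (simp add: n_def)
    have "m \<le> n \<Longrightarrow> T x m = T y m" for m
    proof (induction m)
      case (Suc m)
      then have "(m \<in> x) = (m \<in> y)"
        using not_less_Least[of m "\<lambda>n. (n \<in> x) \<noteq> (n \<in> y)"] by (auto simp: n_def)
      then show ?case using Suc by (simp add: TS)
    qed (simp add: T0)
    then have "T x n = T y n" by simp
    then have "h x \<inter> E (T x (Suc n)) = {} \<or> h x \<inter> E (T y (Suc n)) = {}"
      using s[OF good[of x n]] h(1)[of x] n by (auto simp: TS)
    then show False
      using L[of x "Suc n"] L[of y "Suc n"] h(2)[of x] h(2)[of y] eq by auto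
  qed
  then show ?thesis using h LA by blast
qed

text \<open>Bernstein construction: each reservoir \<open>B\<close> receives two classes meeting
  \<open>[a, B]\<close>, all of them distinct. The classes tagged \<open>True\<close> form
  \<open>\<G>\<close>; for every \<open>B\<close> one class refutes disjointness from
  \<open>\<Union>\<G>\<close> and the other refutes inclusion.\<close>

lemma basic_not_subset:
  assumes a: "finite a" and A: "infinite A"
  shows "\<not> ellentuck_basic a A \<subseteq> M"
proof
  assume sub: "ellentuck_basic a A \<subseteq> M"
  \<comment> \<open>Indices run over all sets of naturals; those that are not infinite subsets of
    \<open>A\<close> default to \<open>A\<close>.\<close>
  define C where "C = (\<lambda>B. if B \<in> inf_subsets A then B else A)"
  define S where "S = (\<lambda>(B, _::bool). {F \<in> \<F>. F \<inter> ellentuck_basic a (C B) \<noteq> {}})"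
  \<comment> \<open>Shifting \<open>X\<close> by one frees \<open>0\<close> to store the tag, so the
    index type embeds into \<open>nat set\<close>.\<close>
  define code where "code = (\<lambda>(X, u). (if u then {0} else {}) \<union> Suc ` X)"
  have "inj code"
  proof (rule injI)
    fix p q assume eq: "code p = code q"
    obtain X u Y v where p: "p = (X, u)" "q = (Y, v)" by fastforce
    have "u = v"
      using arg_cong[OF eq, of "\<lambda>Z. 0 \<in> Z"] by (auto simp: p code_def split: if_splits)
    moreover have "X = Y"
      using arg_cong[OF eq, of "\<lambda>Z. Suc -` Z"]
      by (auto simp: p code_def inj_vimage_image_eq vimage_def split: if_splits)
    ultimately show "p = q" by (simp add: p)
  qed
  have "\<exists>g :: nat set \<times> bool \<Rightarrow> nat set set. inj g \<and> range g \<subseteq> S i" for i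
  proof -
    obtain B u where i: "i = (B, u)" by fastforce
    have C: "C B \<subseteq> A" "infinite (C B)"
      using A by (auto simp: C_def inf_subsets_def)
    have "ellentuck_basic a (C B) \<subseteq> M"
      using sub C(1) basic_mono[of a a "C B" A] by blast
    then obtain h :: "nat set \<Rightarrow> nat set set" where "inj h"
      "range h \<subseteq> {F \<in> \<F>. F \<inter> ellentuck_basic a (C B) \<noteq> {}}"
      using continuum_many_classes[OF a C(2)] by blast
    then have "inj (h \<circ> code)" "range (h \<circ> code) \<subseteq> S i"
      using \<open>inj code\<close> by (auto simp: S_def i inj_compose)
    then show ?thesis by blast
  qed
  then obtain p where p: "inj p" "\<And>i. p i \<in> S i"
    using injective_choice_function[of S] by blast
  define \<G> where "\<G> = range (\<lambda>B. p (B, True))"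
  have "\<G> \<subseteq> \<F>" using p(2) by (fastforce simp: \<G>_def S_def)
  then obtain B where B: "B \<in> inf_subsets A"
    "ellentuck_basic a B \<subseteq> \<Union>\<G> \<or> ellentuck_basic a B \<inter> \<Union>\<G> = {}"
    using CR_Union a A unfolding completely_Ramsey_def by blast
  have P: "p (B, u) \<in> \<F>" "p (B, u) \<inter> ellentuck_basic a B \<noteq> {}" for u
    using p(2)[of "(B, u)"] B(1) by (auto simp: S_def C_def)
  have "p (B, True) \<in> \<G>" by (simp add: \<G>_def)
  then have "ellentuck_basic a B \<subseteq> \<Union>\<G>" using B(2) P(2)[of True] by blast
  then obtain X F where "X \<in> p (B, False)" "F \<in> \<G>" "X \<in> F"
    using P(2)[of False] by blast
  then have "p (B, False) \<in> \<G>"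
    using class_unique[OF P(1)] \<open>\<G> \<subseteq> \<F>\<close> by blast
  then show False using p(1) by (auto simp: \<G>_def inj_def)
qed

end

theorem theorem2:
  fixes M :: "nat set set"
  assumes "M \<subseteq> inf_subsets UNIV"
    and "EL_open M"
    and "large M"
  shows "\<not> (\<exists>\<F>. large_NR_partition M \<F> \<and> EL_dense M \<F> \<and> Kuratowski_partition M \<F>)"
proof
  assume "\<exists>\<F>. large_NR_partition M \<F> \<and> EL_dense M \<F> \<and> Kuratowski_partition M \<F>"
  then obtain \<F> where F: "large_NR_partition M \<F>" "Kuratowski_partition M \<F>" by blast
  interpret NR_Kuratowski_partition M \<F>
    using F unfolding large_NR_partition_def Kuratowski_partition_def
    by (intro NR_Kuratowski_partition.intro) simp_all
  have "\<Union>\<F> = M" using partition by (simp add: partition_on_def)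
  \<comment> \<open>As the union of the whole partition \<open>M\<close> is itself CR, and its
    largeness then forces some basic set into \<open>M\<close>.\<close>
  then have CR: "completely_Ramsey M" using CR_Union[of \<F>] by simp
  obtain a A where a: "finite a" "infinite A"
    and meets: "\<And>B. B \<in> inf_subsets A \<Longrightarrow> ellentuck_basic a B \<inter> M \<noteq> {}"
    using assms(3) unfolding large_def nowhere_Ramsey_def by blast
  obtain B where "B \<in> inf_subsets A" "ellentuck_basic a B \<subseteq> M"
    using CR a meets unfolding completely_Ramsey_def by blast
  then show False
    using basic_not_subset[OF a(1), of B] by (simp add: inf_subsets_def)
qed

end
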